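(* Let $p(\cdot):[0,1]\to[1,\infty)$ be a measurable function, and suppose that the space $C([0,1])$ of continuous real-valued functions on $[0,1]$ is a closed subspace of the variable exponent Lebesgue space $L^{p(\cdot)}([0,1])$ (closed with respect to the norm $\|\cdot\|_{p(\cdot)}$). Then for every linear functional $f$ on $C([0,1])$ that is bounded with respect to the supremum norm $\|x\|_C=\max_{t\in[0,1]}|x(t)|$, there exists a singular linear functional $\varphi\in (L^{p(\cdot)}([0,1]))^{\ast}$ such that $\varphi(x)=f(x)$ for all $x\in C([0,1])$.
   Context: All functions are real-valued, $[0,1]$ carries Lebesgue measure, and functions equal almost everywhere are identified (a continuous function is identified with its a.e.-equivalence class). For a measurable $p(\cdot):[0,1]\to[1,\infty)$ (possibly essentially unbounded), define the modular of a measurable function $x$ on $[0,1]$ by $$\rho_{p(\cdot)}(x)=\int_{[0,1]}|x(t)|^{p(t)}\,dt .$$ The variable Lebesgue space $L^{p(\cdot)}([0,1])$ consists of all measurable $x$ for which there exists $\lambda>0$ with $\rho_{p(\cdot)}(x/\lambda)<\infty$. It is a Banach space under the Luxemburg norm $$\|x\|_{p(\cdot)}=\inf\{\lambda>0:\ \rho_{p(\cdot)}(x/\lambda)\le 1\}.$$ $(L^{p(\cdot)}([0,1]))^{\ast}$ denotes the space of all linear functionals on $L^{p(\cdot)}([0,1])$ that are bounded with respect to $\|\cdot\|_{p(\cdot)}$. Let $$E^{p(\cdot)}([0,1])=\{x:\ \rho_{p(\cdot)}(\lambda x)<\infty \text{ for every } \lambda>0\},$$ a closed subspace of $L^{p(\cdot)}([0,1])$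 (the subspace of order continuous elements). A functional $\varphi\in (L^{p(\cdot)}([0,1]))^{\ast}$ is called singular if $\varphi(x)=0$ for all $x\in E^{p(\cdot)}([0,1])$. *)

theory Defs
  imports "HOL-Analysis.Analysis"
begin

text \<open>
  Elements of the function spaces are represented by functions \<open>real \<Rightarrow> real\<close>, of which only the
  values on \<open>[0,1]\<close> matter. Functions equal almost everywhere are identified by working with
  representatives: the norms below are seminorms on representatives, and a functional that is
  bounded for such a seminorm is constant on classes (see \<open>var_Lp_dual_cong_AE\<close> below), so it is
  the same thing as a bounded functional on the space of classes.
\<close>

abbreviation leb01 :: "real measure" where
  "leb01 \<equiv> lebesgue_on {0..1}"

definition variable_exponent :: "(real \<Rightarrow> real) \<Rightarrow> bool" where
  "variable_exponent p \<longleftrightarrow> p \<in> borel_measurable leb01 \<and> (\<forall>t\<in>{0..1}. 1 \<le> p t)"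

definition modular :: "(real \<Rightarrow> real) \<Rightarrow> (real \<Rightarrow> real) \<Rightarrow> ennreal" where
  "modular p x = (\<integral>\<^sup>+ t. ennreal (\<bar>x t\<bar> powr p t) \<partial>leb01)"

definition var_Lp :: "(real \<Rightarrow> real) \<Rightarrow> (real \<Rightarrow> real) set" where
  "var_Lp p = {x \<in> borel_measurable leb01. \<exists>l>0. modular p (\<lambda>t. x t / l) < \<infinity>}"

definition luxemburg_norm :: "(real \<Rightarrow> real) \<Rightarrow> (real \<Rightarrow> real) \<Rightarrow> real" where
  "luxemburg_norm p x = Inf {l. 0 < l \<and> modular p (\<lambda>t. x t / l) \<le> 1}"

definition var_Ep :: "(real \<Rightarrow> real) \<Rightarrow> (real \<Rightarrow> real) set" where
  "var_Ep p = {x \<in> borel_measurable leb01. \<forall>l>0. modular p (\<lambda>t. l * x t) < \<infinity>}"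

definition C01 :: "(real \<Rightarrow> real) set" where
  "C01 = {x. continuous_on {0..1} x}"

definition sup_norm01 :: "(real \<Rightarrow> real) \<Rightarrow> real" where
  "sup_norm01 x = (SUP t\<in>{0..1}. \<bar>x t\<bar>)"

definition linear_functional_on ::
    "(real \<Rightarrow> real) set \<Rightarrow> ((real \<Rightarrow> real) \<Rightarrow> real) \<Rightarrow> bool" where
  "linear_functional_on V \<phi> \<longleftrightarrow>
     (\<forall>x\<in>V. \<forall>y\<in>V. \<phi> (\<lambda>t. x t + y t) = \<phi> x + \<phi> y) \<and>
     (\<forall>c. \<forall>x\<in>V. \<phi> (\<lambda>t. c * x t) = c * \<phi> x)"

definition bounded_functionals ::
    "(real \<Rightarrow> real) set \<Rightarrow> ((real \<Rightarrow> real) \<Rightarrow> real) \<Rightarrow> ((real \<Rightarrow> real) \<Rightarrow> real) set" where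
  "bounded_functionals V N =
     {\<phi>. linear_functional_on V \<phi> \<and> (\<exists>K. \<forall>x\<in>V. \<bar>\<phi> x\<bar> \<le> K * N x)}"

abbreviation var_Lp_dual :: "(real \<Rightarrow> real) \<Rightarrow> ((real \<Rightarrow> real) \<Rightarrow> real) set" where
  "var_Lp_dual p \<equiv> bounded_functionals (var_Lp p) (luxemburg_norm p)"

definition singular_functional :: "(real \<Rightarrow> real) \<Rightarrow> ((real \<Rightarrow> real) \<Rightarrow> real) \<Rightarrow> bool" where
  "singular_functional p \<phi> \<longleftrightarrow> \<phi> \<in> var_Lp_dual p \<and> (\<forall>x\<in>var_Ep p. \<phi> x = 0)"

text \<open>
  The classes of the members of \<open>S\<close> form a norm-closed subset of the space of classes: every
  element of the space that is approximated arbitrarily well by members of \<open>S\<close> agrees almost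
  everywhere with a member of \<open>S\<close>.
\<close>
definition closed_in_var_Lp :: "(real \<Rightarrow> real) \<Rightarrow> (real \<Rightarrow> real) set \<Rightarrow> bool" where
  "closed_in_var_Lp p S \<longleftrightarrow>
     S \<subseteq> var_Lp p \<and>
     (\<forall>x\<in>var_Lp p. (\<forall>e>0. \<exists>y\<in>S. luxemburg_norm p (\<lambda>t. x t - y t) < e)
        \<longrightarrow> (\<exists>y\<in>S. AE t in leb01. x t = y t))"

lemma modular_AE_zero:
  assumes "AE t in leb01. z t = 0"
  shows "modular p (\<lambda>t. z t / l) = 0"
proof -
  have "modular p (\<lambda>t. z t / l) = (\<integral>\<^sup>+ t. 0 \<partial>leb01)"
    unfolding modular_def by (rule nn_integral_cong_AE) (use assms in auto)
  then show ?thesis by simp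
qed

lemma var_Lp_dual_cong_AE:
  assumes \<phi>: "\<phi> \<in> var_Lp_dual p"
    and x: "x \<in> var_Lp p" and y: "y \<in> var_Lp p"
    and eq: "AE t in leb01. x t = y t"
  shows "\<phi> x = \<phi> y"
proof -
  define z where "z = (\<lambda>t. x t - y t)"
  have z0: "modular p (\<lambda>t. z t / l) = 0" for l
    by (rule modular_AE_zero) (use eq in \<open>auto simp: z_def\<close>)
  have "z \<in> borel_measurable leb01"
    using x y by (auto simp: z_def var_Lp_def)
  then have z: "z \<in> var_Lp p"
    by (auto simp: var_Lp_def z0 intro: exI[of _ 1])
  have "luxemburg_norm p z = Inf {0<..}"
    by (simp add: luxemburg_norm_def z0 greaterThan_def)
  then have "luxemburg_norm p z = 0" by simp
  moreover obtain K where "\<bar>\<phi> z\<bar> \<le> K * luxemburg_norm p z"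
    using \<phi> z by (auto simp: bounded_functionals_def)
  ultimately have "\<phi> z = 0" by simp
  moreover have "\<phi> (\<lambda>t. y t + z t) = \<phi> y + \<phi> z"
    using \<phi> y z by (auto simp: bounded_functionals_def linear_functional_on_def)
  moreover have "(\<lambda>t. y t + z t) = x" by (simp add: z_def)
  ultimately show ?thesis by simp
qed

end

theory Submission
  imports Defs "HOL-Library.Function_Algebras"
begin

text \<open>
  If \<open>C01\<close> is closed, then for some \<open>c\<close> the modular of \<open>c\<close> times the indicator of any
  subinterval exceeds 1; subdividing the interval shows that it is infinite. Now let \<open>x\<close> be
  continuous and \<open>y \<in> var_Ep p\<close>. On some interval \<open>\<bar>x\<bar>\<close> is at least half its maximum, and no
  multiple of \<open>y\<close> can account for the infinite modular there, so \<open>x + y\<close> must: its norm is at least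
  a fixed multiple of the supremum norm of \<open>x\<close>. Hence \<open>x + y \<mapsto> f x\<close> is bounded on
  \<open>C01 + var_Ep p\<close>, and any Hahn-Banach extension of it is singular and extends \<open>f\<close>.
\<close>

section \<open>The Hahn-Banach theorem\<close>

text \<open>
  The functional to be extended is given as a linear relation; the bound by \<open>q\<close> forces
  the relation to be single-valued.
\<close>

lemma hahn_banach_step:
  fixes s :: "real \<Rightarrow> 'b::ab_group_add \<Rightarrow> 'b"
  assumes "vector_space s"
    and V: "module.subspace s V"
    and q_add: "\<And>x y. x \<in> V \<Longrightarrow> y \<in> V \<Longrightarrow> q (x + y) \<le> q x + q y"
    and q_scale: "\<And>c x. 0 < c \<Longrightarrow> x \<in> V \<Longrightarrow> q (s c x) = c * q x"
    and sub: "M \<subseteq> V \<times> UNIV" and zero: "(0, 0) \<in> M"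
    and add: "\<And>x y a b. (x, a) \<in> M \<Longrightarrow> (y, b) \<in> M \<Longrightarrow> (x + y, a + b) \<in> M"
    and scale: "\<And>c x a. (x, a) \<in> M \<Longrightarrow> (s c x, c * a) \<in> M"
    and bound: "\<And>x a. (x, a) \<in> M \<Longrightarrow> a \<le> q x"
    and z: "z \<in> V"
  obtains c :: real where "\<And>y a t. (y, a) \<in> M \<Longrightarrow> a + t * c \<le> q (y + s t z)"
proof -
  interpret vector_space s by fact
  \<comment> \<open>Extending to \<open>z\<close> with value \<open>c\<close> asks for
    \<open>a - q (y - z) \<le> c\<close> and \<open>c \<le> q (w + z) - b\<close>. Every lower bound
    lies below every upper bound because \<open>y + w = (y - z) + (w + z)\<close> and
    \<open>q\<close> is subadditive.\<close>
  have cross: "a - q (y - z) \<le> q (w + z) - b" if "(y, a) \<in> M" "(w, b) \<in> M" for y a w b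
  proof -
    have V': "y - z \<in> V" "w + z \<in> V"
      using that sub z V by (auto intro: subspace_add subspace_diff)
    have "a + b \<le> q (y + w)"
      using bound add that by blast
    also have "y + w = (y - z) + (w + z)" by simp
    also have "q \<dots> \<le> q (y - z) + q (w + z)"
      using V' by (rule q_add)
    finally show ?thesis by simp
  qed
  \<comment> \<open>Any number in the gap would do; the least one is the supremum of the lower
    bounds. The pair \<open>(0, 0)\<close> makes the set nonempty and also supplies its upper
    bound.\<close>
  define c where "c = (SUP (y, a) \<in> M. a - q (y - z))"
  have bdd: "bdd_above ((\<lambda>(y, a). a - q (y - z)) ` M)"
    using cross[OF _ zero] by (intro bdd_aboveI[of _ "q (0 + z) - 0"]) auto
  have lower: "a - q (y - z) \<le> c" if "(y, a) \<in> M" for y a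
    unfolding c_def using cSUP_upper[OF that bdd] by simp
  have upper: "c \<le> q (y + z) - a" if "(y, a) \<in> M" for y a
    unfolding c_def using zero cross[OF _ that] by (intro cSUP_least) auto
  show thesis
  proof (rule that)
    fix y a and t :: real
    assume ya: "(y, a) \<in> M"
    have yV: "y \<in> V" using ya sub by auto
    \<comment> \<open>Dividing by the absolute value of \<open>t\<close> reduces the claim to
      \<open>t = 1\<close> or \<open>t = -1\<close>, which are \<open>upper\<close> and
      \<open>lower\<close>; positive homogeneity of \<open>q\<close> scales back.\<close>
    consider "t = 0" | "0 < t" | "t < 0" by linarith
    then show "a + t * c \<le> q (y + s t z)"
    proof cases
      case 1
      then show ?thesis using bound[OF ya] by simp
    next
      case 2
      have "c \<le> q (s (1/t) y + z) - (1/t) * a"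
        using upper[OF scale[OF ya]] .
      then have "t * c \<le> t * (q (s (1/t) y + z) - (1/t) * a)"
        using 2 by (intro mult_left_mono) auto
      also have "\<dots> = t * q (s (1/t) y + z) - a"
        using 2 by (simp add: right_diff_distrib)
      also have "t * q (s (1/t) y + z) = q (s t (s (1/t) y + z))"
        using 2 z yV V by (intro q_scale[symmetric] subspace_add subspace_scale) auto
      also have "s t (s (1/t) y + z) = y + s t z"
        using 2 by (simp add: scale_right_distrib)
      finally show ?thesis by simp
    next
      case 3
      define r where "r = - t"
      have r: "0 < r" using 3 by (simp add: r_def)
      have "(1/r) * a - q (s (1/r) y - z) \<le> c"
        using lower[OF scale[OF ya]] .
      then have "r * ((1/r) * a - q (s (1/r) y - z)) \<le> r * c"
        using r by (intro mult_left_mono) auto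
      moreover have "r * ((1/r) * a - q (s (1/r) y - z)) = a - r * q (s (1/r) y - z)"
        using r by (simp add: right_diff_distrib)
      moreover have "r * q (s (1/r) y - z) = q (s r (s (1/r) y - z))"
        using r z yV V by (intro q_scale[symmetric] subspace_diff subspace_scale) auto
      moreover have "s r (s (1/r) y - z) = y + s t z"
        using r by (simp add: scale_right_diff_distrib r_def)
      ultimately show ?thesis by (simp add: r_def)
    qed
  qed
qed

text \<open>Zorn's lemma yields a maximal linear relation that contains \<open>G\<close> and is
  dominated by \<open>q\<close>. Were its domain not all of \<open>V\<close>, the one-step extension
  would enlarge it.\<close>

lemma hahn_banach:
  fixes s :: "real \<Rightarrow> 'b::ab_group_add \<Rightarrow> 'b"
  assumes vs: "vector_space s"
    and V: "module.subspace s V"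
    and q_add: "\<And>x y. x \<in> V \<Longrightarrow> y \<in> V \<Longrightarrow> q (x + y) \<le> q x + q y"
    and q_scale: "\<And>c x. 0 < c \<Longrightarrow> x \<in> V \<Longrightarrow> q (s c x) = c * q x"
    and sub: "G \<subseteq> V \<times> UNIV" and zero: "(0, 0) \<in> G"
    and add: "\<And>x y a b. (x, a) \<in> G \<Longrightarrow> (y, b) \<in> G \<Longrightarrow> (x + y, a + b) \<in> G"
    and scale: "\<And>c x a. (x, a) \<in> G \<Longrightarrow> (s c x, c * a) \<in> G"
    and bound: "\<And>x a. (x, a) \<in> G \<Longrightarrow> a \<le> q x"
  obtains \<phi> :: "'b \<Rightarrow> real" where
    "\<And>x y. x \<in> V \<Longrightarrow> y \<in> V \<Longrightarrow> \<phi> (x + y) = \<phi> x + \<phi> y"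
    "\<And>c x. x \<in> V \<Longrightarrow> \<phi> (s c x) = c * \<phi> x"
    "\<And>x. x \<in> V \<Longrightarrow> \<phi> x \<le> q x"
    "\<And>x a. (x, a) \<in> G \<Longrightarrow> \<phi> x = a"
proof -
  interpret vector_space s by fact
  define \<A> where "\<A> = {M. G \<subseteq> M \<and> M \<subseteq> V \<times> UNIV \<and>
    (\<forall>x y a b. (x, a) \<in> M \<longrightarrow> (y, b) \<in> M \<longrightarrow> (x + y, a + b) \<in> M) \<and>
    (\<forall>c x a. (x, a) \<in> M \<longrightarrow> (s c x, c * a) \<in> M) \<and> (\<forall>x a. (x, a) \<in> M \<longrightarrow> a \<le> q x)}"
  have \<A>I: "M \<in> \<A>" if "G \<subseteq> M" "M \<subseteq> V \<times> UNIV"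
    "\<And>x y a b. (x, a) \<in> M \<Longrightarrow> (y, b) \<in> M \<Longrightarrow> (x + y, a + b) \<in> M"
    "\<And>c x a. (x, a) \<in> M \<Longrightarrow> (s c x, c * a) \<in> M"
    "\<And>x a. (x, a) \<in> M \<Longrightarrow> a \<le> q x" for M
    unfolding \<A>_def using that by (intro CollectI conjI allI impI)
  have \<A>D: "G \<subseteq> M" "M \<subseteq> V \<times> UNIV"
    "\<And>x y a b. (x, a) \<in> M \<Longrightarrow> (y, b) \<in> M \<Longrightarrow> (x + y, a + b) \<in> M"
    "\<And>c x a. (x, a) \<in> M \<Longrightarrow> (s c x, c * a) \<in> M"
    "\<And>x a. (x, a) \<in> M \<Longrightarrow> a \<le> q x" if "M \<in> \<A>" for M
    using that unfolding \<A>_def by simp_all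
  have "\<exists>M\<in>\<A>. \<forall>X\<in>\<A>. M \<subseteq> X \<longrightarrow> X = M"
  proof (rule subset_Zorn_nonempty)
    have "G \<in> \<A>"
      using sub add scale bound by (intro \<A>I order_refl)
    then show "\<A> \<noteq> {}" by blast
  next
    fix \<C> assume ne: "\<C> \<noteq> {}" and ch: "subset.chain \<A> \<C>"
    have \<C>\<A>: "\<And>M. M \<in> \<C> \<Longrightarrow> M \<in> \<A>"
      using ch by (auto simp: subset.chain_def)
    show "\<Union>\<C> \<in> \<A>"
    proof (rule \<A>I)
      obtain M where "M \<in> \<C>" using ne by blast
      then show "G \<subseteq> \<Union>\<C>"
        using \<A>D(1)[OF \<C>\<A>] by blast
      show "\<Union>\<C> \<subseteq> V \<times> UNIV"
        using \<A>D(2)[OF \<C>\<A>] by (rule Union_least)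
    next
      fix x y a b assume xa: "(x, a) \<in> \<Union>\<C>" and yb: "(y, b) \<in> \<Union>\<C>"
      obtain X Y where XY: "X \<in> \<C>" "(x, a) \<in> X" "Y \<in> \<C>" "(y, b) \<in> Y"
        using xa yb by blast
      \<comment> \<open>Addition involves two pairs, so both must first be placed in a single member
        of the chain.\<close>
      have "X \<subseteq> Y \<or> Y \<subseteq> X"
        using ch XY by (auto simp: subset.chain_def)
      then obtain Z where Z: "Z \<in> \<C>" "(x, a) \<in> Z" "(y, b) \<in> Z"
        using XY by blast
      then show "(x + y, a + b) \<in> \<Union>\<C>"
        using \<A>D(3)[OF \<C>\<A>[OF Z(1)] Z(2,3)] by (intro UnionI)
    next
      fix c x a assume "(x, a) \<in> \<Union>\<C>"
      then obtain Z where Z: "Z \<in> \<C>" "(x, a) \<in> Z" by blast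
      then show "(s c x, c * a) \<in> \<Union>\<C>"
        using \<A>D(4)[OF \<C>\<A>[OF Z(1)] Z(2)] by (intro UnionI)
      show "a \<le> q x"
        using \<A>D(5)[OF \<C>\<A>[OF Z(1)] Z(2)] .
    qed
  qed
  then obtain M where M: "M \<in> \<A>" and max: "\<And>X. X \<in> \<A> \<Longrightarrow> M \<subseteq> X \<Longrightarrow> X = M"
    by blast
  note GM = \<A>D(1)[OF M] and MV = \<A>D(2)[OF M] and M_add = \<A>D(3)[OF M]
    and M_scale = \<A>D(4)[OF M] and M_bound = \<A>D(5)[OF M]
  have M0: "(0, 0) \<in> M" using GM zero by blast
  have "\<exists>a. (z, a) \<in> M" if z: "z \<in> V" for z
  proof -
    obtain c :: real where c: "\<And>y a t. (y, a) \<in> M \<Longrightarrow> a + t * c \<le> q (y + s t z)"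
      using hahn_banach_step[OF vs V q_add q_scale MV M0 M_add M_scale M_bound z] by blast
    \<comment> \<open>The sum of \<open>M\<close> and the line spanned by \<open>(z, c)\<close>.
      Once \<open>X\<close> is known to lie in \<open>\<A>\<close>, maximality gives
      \<open>X = M\<close>, which therefore contains \<open>(z, c)\<close>.\<close>
    define X where "X = {(y + s t z, a + t * c) | y a t. (y, a) \<in> M}"
    have XI: "(y, a) \<in> M \<Longrightarrow> u = y + s t z \<Longrightarrow> b = a + t * c \<Longrightarrow> (u, b) \<in> X" for y a t u b
      unfolding X_def by blast
    have XE: "\<exists>y t a. (y, a) \<in> M \<and> u = y + s t z \<and> b = a + t * c" if "(u, b) \<in> X" for u b
      using that unfolding X_def by blast
    have MX: "M \<subseteq> X"
      by (auto intro: XI[where t = 0])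
    moreover have "X \<subseteq> V \<times> UNIV"
      using MV z V unfolding X_def by (auto intro!: subspace_add subspace_scale)
    moreover have "(u + v, a + b) \<in> X" if ua: "(u, a) \<in> X" and vb: "(v, b) \<in> X" for u v a b
    proof -
      obtain y t a' w r b' where yw: "(y, a') \<in> M" "(w, b') \<in> M"
        and eq: "u = y + s t z" "v = w + s r z" "a = a' + t * c" "b = b' + r * c"
        using XE[OF ua] XE[OF vb] by blast
      show ?thesis
        by (rule XI[OF M_add[OF yw], where t = "t + r"])
          (simp_all add: eq scale_left_distrib algebra_simps)
    qed
    moreover have "(s k u, k * a) \<in> X" if ua: "(u, a) \<in> X" for k u a
    proof -
      obtain y t a' where y: "(y, a') \<in> M" and eq: "u = y + s t z" "a = a' + t * c"
        using XE[OF ua] by blast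
      show ?thesis
        by (rule XI[OF M_scale[OF y, of k], where t = "k * t"])
          (simp_all add: eq scale_right_distrib algebra_simps)
    qed
    moreover have "a \<le> q u" if "(u, a) \<in> X" for u a
      using XE[OF that] c by blast
    ultimately have "X \<in> \<A>"
      using subset_trans[OF GM MX] by (intro \<A>I)
    then have "X = M" using max MX by blast
    moreover have "(z, c) \<in> X"
      by (rule XI[OF M0, where t = 1]) simp_all
    ultimately show ?thesis by blast
  qed
  then obtain \<phi> where \<phi>: "\<And>x. x \<in> V \<Longrightarrow> (x, \<phi> x) \<in> M" by metis
  \<comment> \<open>Subtracting two pairs over the same point gives \<open>(0, a - b)\<close>, and
    \<open>q 0 \<le> 0\<close> forces \<open>a \<le> b\<close>; the roles are then
    exchanged.\<close>
  have unique: "a = b" if xa: "(x, a) \<in> M" and xb: "(x, b) \<in> M" for x a b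
  proof -
    have q0: "q 0 \<le> 0"
      using q_scale[of 2 0] subspace_0[OF V] by simp
    have le: "a \<le> b" if xa: "(x, a) \<in> M" and xb: "(x, b) \<in> M" for a b
    proof -
      have "(x + s (- 1) x, a + (- 1) * b) \<in> M"
        using M_add[OF xa M_scale[OF xb]] .
      then have "a + (- 1) * b \<le> q (x + s (- 1) x)"
        by (rule M_bound)
      then show ?thesis using q0 by simp
    qed
    show ?thesis using le xa xb by (meson order_antisym)
  qed
  show thesis
  proof (rule that)
    show "\<phi> (x + y) = \<phi> x + \<phi> y" if "x \<in> V" "y \<in> V" for x y
      using unique[OF \<phi>[OF subspace_add[OF V that]] M_add[OF \<phi>[OF that(1)] \<phi>[OF that(2)]]] .
    show "\<phi> (s c x) = c * \<phi> x" if "x \<in> V" for c x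
      using unique[OF \<phi>[OF subspace_scale[OF V that]] M_scale[OF \<phi>[OF that]]] .
    show "\<phi> x \<le> q x" if "x \<in> V" for x
      using M_bound[OF \<phi>[OF that]] .
    show "\<phi> x = a" if "(x, a) \<in> G" for x a
      using that GM MV by (intro unique[OF \<phi>]) auto
  qed
qed

section \<open>The modular and the Luxemburg norm\<close>

lemma modular_measurable [measurable]:
  assumes "variable_exponent p" "x \<in> borel_measurable leb01"
  shows "(\<lambda>t. ennreal (\<bar>x t\<bar> powr p t)) \<in> borel_measurable leb01"
proof -
  have [measurable]: "p \<in> borel_measurable leb01" "x \<in> borel_measurable leb01"
    using assms by (auto simp: variable_exponent_def)
  show ?thesis by measurable
qed

lemma modular_mono_AE:
  assumes "variable_exponent p" "AE t in leb01. \<bar>x t\<bar> \<le> \<bar>y t\<bar>"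
  shows "modular p x \<le> modular p y"
  unfolding modular_def
proof (rule nn_integral_mono_AE)
  have "AE t in leb01. t \<in> {0..1}"
    using AE_space[of leb01] by simp
  then show "AE t in leb01. ennreal (\<bar>x t\<bar> powr p t) \<le> ennreal (\<bar>y t\<bar> powr p t)"
    using assms(2)
  proof eventually_elim
    case (elim t)
    have "0 \<le> p t"
      using assms(1) elim(1) by (auto simp: variable_exponent_def intro: order_trans[OF zero_le_one])
    then show ?case
      using elim(2) by (intro ennreal_leI powr_mono2) auto
  qed
qed

lemma modular_mono:
  assumes "variable_exponent p" "\<And>t. t \<in> {0..1} \<Longrightarrow> \<bar>x t\<bar> \<le> \<bar>y t\<bar>"
  shows "modular p x \<le> modular p y"
proof (rule modular_mono_AE[OF assms(1)])
  have "AE t in leb01. t \<in> {0..1}"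
    using AE_space[of leb01] by simp
  then show "AE t in leb01. \<bar>x t\<bar> \<le> \<bar>y t\<bar>"
    by eventually_elim (rule assms(2))
qed

section \<open>Convexity of the modular\<close>

lemma powr_scale_le:
  fixes u :: real
  assumes "0 \<le> c" "c \<le> 1" "0 \<le> u" "1 \<le> r"
  shows "(c * u) powr r \<le> c * u powr r"
proof -
  have "c powr r \<le> c"
  proof (cases "c = 0")
    case False
    then show ?thesis
      using assms powr_mono'[of 1 r c] by simp
  qed simp
  then show ?thesis
    using assms by (simp add: powr_mult mult_right_mono)
qed

text \<open>For positive arguments this is convexity of the power function with exponent at least 1.
  If one argument vanishes, it reduces to \<open>powr_scale_le\<close>.\<close>

lemma powr_convex_nonneg:
  fixes u v :: real
  assumes "0 \<le> c" "c \<le> 1" "0 \<le> u" "0 \<le> v" "1 \<le> r"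
  shows "(c * u + (1 - c) * v) powr r \<le> c * u powr r + (1 - c) * v powr r"
proof -
  consider "u = 0" | "v = 0" | "0 < u" "0 < v" using assms by linarith
  then show ?thesis
  proof cases
    case 1
    then show ?thesis using powr_scale_le[of "1 - c" v r] assms by simp
  next
    case 2
    then show ?thesis using powr_scale_le[of c u r] assms by simp
  next
    case 3
    then show ?thesis
      using convex_onD[OF powr_convex[OF assms(5)], of "1 - c" u v] assms by simp
  qed
qed

text \<open>Integrates \<open>powr_scale_le\<close>, whose bound does not depend on the size of
  \<open>p\<close>. Hence even for unbounded exponents a factor of height can be traded for a small
  modular.\<close>

lemma modular_scale_le:
  assumes p: "variable_exponent p" and x: "x \<in> borel_measurable leb01" and c: "0 \<le> c" "c \<le> 1"
  shows "modular p (\<lambda>t. c * x t) \<le> ennreal c * modular p x"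
proof -
  have "modular p (\<lambda>t. c * x t) \<le> (\<integral>\<^sup>+ t. ennreal c * ennreal (\<bar>x t\<bar> powr p t) \<partial>leb01)"
    unfolding modular_def
  proof (rule nn_integral_mono)
    fix t assume "t \<in> space leb01"
    then have "1 \<le> p t" using p by (auto simp: variable_exponent_def)
    then show "ennreal (\<bar>c * x t\<bar> powr p t) \<le> ennreal c * ennreal (\<bar>x t\<bar> powr p t)"
      using c powr_scale_le[of c "\<bar>x t\<bar>" "p t"]
      by (simp add: abs_mult flip: ennreal_mult)
  qed
  also have "\<dots> = ennreal c * modular p x"
    unfolding modular_def using p x by (intro nn_integral_cmult modular_measurable)
  finally show ?thesis .
qed

lemma modular_convex:
  assumes p: "variable_exponent p"
    and x: "x \<in> borel_measurable leb01" and y: "y \<in> borel_measurable leb01"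
    and c: "0 \<le> c" "c \<le> 1"
  shows "modular p (\<lambda>t. c * x t + (1 - c) * y t)
    \<le> ennreal c * modular p x + ennreal (1 - c) * modular p y"
proof -
  note [measurable] = modular_measurable[OF p x] modular_measurable[OF p y]
  have "modular p (\<lambda>t. c * x t + (1 - c) * y t) \<le> (\<integral>\<^sup>+ t. ennreal c * ennreal (\<bar>x t\<bar> powr p t)
      + ennreal (1 - c) * ennreal (\<bar>y t\<bar> powr p t) \<partial>leb01)"
    unfolding modular_def
  proof (rule nn_integral_mono)
    fix t assume "t \<in> space leb01"
    then have pt: "1 \<le> p t" using p by (auto simp: variable_exponent_def)
    have "\<bar>c * x t + (1 - c) * y t\<bar> \<le> c * \<bar>x t\<bar> + (1 - c) * \<bar>y t\<bar>"
      using c abs_triangle_ineq[of "c * x t" "(1 - c) * y t"] by (simp add: abs_mult)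
    then have "\<bar>c * x t + (1 - c) * y t\<bar> powr p t \<le> (c * \<bar>x t\<bar> + (1 - c) * \<bar>y t\<bar>) powr p t"
      using pt by (intro powr_mono2) auto
    also have "\<dots> \<le> c * \<bar>x t\<bar> powr p t + (1 - c) * \<bar>y t\<bar> powr p t"
      using c pt by (intro powr_convex_nonneg) auto
    finally show "ennreal (\<bar>c * x t + (1 - c) * y t\<bar> powr p t)
      \<le> ennreal c * ennreal (\<bar>x t\<bar> powr p t) + ennreal (1 - c) * ennreal (\<bar>y t\<bar> powr p t)"
      using c by (simp flip: ennreal_mult ennreal_plus)
  qed
  also have "\<dots> = ennreal c * modular p x + ennreal (1 - c) * modular p y"
    unfolding modular_def 
    by (simp add: nn_integral_add nn_integral_cmult modular_measurable[OF p x] modular_measurable[OF p y])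
  finally show ?thesis .
qed

text \<open>A non-convex substitute for the triangle inequality that needs no doubling condition.\<close>

lemma modular_le_add:
  assumes p: "variable_exponent p"
    and y: "y \<in> borel_measurable leb01" and z: "z \<in> borel_measurable leb01"
    and le: "\<And>t. t \<in> {0..1} \<Longrightarrow> \<bar>x t\<bar> \<le> \<bar>y t\<bar> + \<bar>z t\<bar>"
  shows "modular p x \<le> modular p (\<lambda>t. 2 * y t) + modular p (\<lambda>t. 2 * z t)"
proof -
  \<comment> \<open>The sum is written as the midpoint of \<open>2 * \<bar>y t\<bar>\<close> and
    \<open>2 * \<bar>z t\<bar>\<close>, so that convexity applies.\<close>
  have "modular p x \<le> modular p (\<lambda>t. (1/2) * (2 * \<bar>y t\<bar>) + (1 - 1/2) * (2 * \<bar>z t\<bar>))"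
    using le by (intro modular_mono[OF p]) auto
  also have "\<dots> \<le> ennreal (1/2) * modular p (\<lambda>t. 2 * \<bar>y t\<bar>)
      + ennreal (1 - 1/2) * modular p (\<lambda>t. 2 * \<bar>z t\<bar>)"
    using y z by (intro modular_convex[OF p]) auto
  also have "\<dots> \<le> 1 * modular p (\<lambda>t. 2 * \<bar>y t\<bar>) + 1 * modular p (\<lambda>t. 2 * \<bar>z t\<bar>)"
    by (intro add_mono mult_right_mono zero_le) (subst ennreal_le_1, simp)+
  finally show ?thesis
    by (simp add: modular_def abs_mult)
qed

section \<open>The Luxemburg norm as a seminorm\<close>

lemma luxemburg_norm_le:
  assumes "0 < l" "modular p (\<lambda>t. x t / l) \<le> 1"
  shows "luxemburg_norm p x \<le> l"
  unfolding luxemburg_norm_def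
  using assms by (intro cInf_lower bdd_belowI[of _ 0]) auto

lemma luxemburg_set_nonempty:
  assumes p: "variable_exponent p" and x: "x \<in> var_Lp p"
  shows "\<exists>l>0. modular p (\<lambda>t. x t / l) \<le> 1"
proof -
  obtain l where xm: "x \<in> borel_measurable leb01" and l: "0 < l" "modular p (\<lambda>t. x t / l) < \<infinity>"
    using x by (auto simp: var_Lp_def)
  define m where "m = enn2real (modular p (\<lambda>t. x t / l))"
  have m: "modular p (\<lambda>t. x t / l) = ennreal m" "0 \<le> m"
    using l by (auto simp: m_def less_top)
  \<comment> \<open>Chosen so that \<open>c * m \<le> 1\<close>; the summand 1 keeps
    \<open>c\<close> at most 1 and defined when \<open>m = 0\<close>.\<close>
  define c where "c = 1 / (1 + m)"
  have c: "0 < c" "c \<le> 1" "c * m \<le> 1"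
    using m by (auto simp: c_def divide_simps)
  have "modular p (\<lambda>t. c * (x t / l)) \<le> ennreal c * modular p (\<lambda>t. x t / l)"
    using xm c by (intro modular_scale_le[OF p]) auto
  also have "\<dots> \<le> 1"
    using c m by (simp add: ennreal_le_1 flip: ennreal_mult)
  finally have "modular p (\<lambda>t. x t / (l / c)) \<le> 1"
    by (simp add: mult.commute)
  then show ?thesis
    using l c by (intro exI[of _ "l / c"]) auto
qed

text \<open>Some admissible \<open>k\<close> lies below \<open>l\<close>, and the modular decreases
  as the divisor grows. The strict hypothesis avoids the question whether the infimum is attained;
  later estimates take \<open>l\<close> slightly above the norm.\<close>

lemma modular_le_1:
  assumes p: "variable_exponent p" and x: "x \<in> var_Lp p" and l: "luxemburg_norm p x < l"
  shows "0 < l \<and> modular p (\<lambda>t. x t / l) \<le> 1"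
proof -
  have "\<exists>k\<in>{k. 0 < k \<and> modular p (\<lambda>t. x t / k) \<le> 1}. k < l"
    using l luxemburg_set_nonempty[OF p x] unfolding luxemburg_norm_def
    by (subst cInf_less_iff[symmetric]) (auto intro!: bdd_belowI[of _ 0])
  then obtain k where k: "0 < k" "modular p (\<lambda>t. x t / k) \<le> 1" "k < l" by blast
  have "modular p (\<lambda>t. x t / l) \<le> modular p (\<lambda>t. x t / k)"
    using k by (intro modular_mono[OF p]) (simp add: abs_divide frac_le)
  with k show ?thesis by auto
qed

lemma luxemburg_norm_nonneg:
  assumes "variable_exponent p" "x \<in> var_Lp p"
  shows "0 \<le> luxemburg_norm p x"
  using modular_le_1[OF assms] by (meson not_less order_less_irrefl)

lemma var_LpI:
  assumes "x \<in> borel_measurable leb01" "0 < l" "modular p (\<lambda>t. x t / l) \<le> 1"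
  shows "x \<in> var_Lp p"
  using assms le_less_trans[OF assms(3), of \<infinity>] unfolding var_Lp_def by auto

lemma luxemburg_add:
  assumes p: "variable_exponent p" and x: "x \<in> var_Lp p" and y: "y \<in> var_Lp p"
  shows "(\<lambda>t. x t + y t) \<in> var_Lp p"
    and "luxemburg_norm p (\<lambda>t. x t + y t) \<le> luxemburg_norm p x + luxemburg_norm p y"
proof -
  have xm: "x \<in> borel_measurable leb01" and ym: "y \<in> borel_measurable leb01"
    using x y by (auto simp: var_Lp_def)
  \<comment> \<open>\<open>(x + y) / (a + b)\<close> is the convex combination of
    \<open>x / a\<close> and \<open>y / b\<close> with weights \<open>a / (a + b)\<close> and
    \<open>b / (a + b)\<close>.\<close>
  have *: "modular p (\<lambda>t. (x t + y t) / (a + b)) \<le> 1 \<and> 0 < a + b"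
    if a: "luxemburg_norm p x < a" and b: "luxemburg_norm p y < b" for a b
  proof -
    have a': "0 < a" "modular p (\<lambda>t. x t / a) \<le> 1" and b': "0 < b" "modular p (\<lambda>t. y t / b) \<le> 1"
      using modular_le_1[OF p x a] modular_le_1[OF p y b] by auto
    define c where "c = a / (a + b)"
    have c: "0 \<le> c" "c \<le> 1" "1 - c = b / (a + b)"
      using a' b' by (auto simp: c_def field_simps)
    have "modular p (\<lambda>t. (x t + y t) / (a + b)) = modular p (\<lambda>t. c * (x t / a) + (1 - c) * (y t / b))"
      unfolding c(3) using a' b' by (simp add: c_def add_divide_distrib)
    also have "\<dots> \<le> ennreal c * modular p (\<lambda>t. x t / a)
        + ennreal (1 - c) * modular p (\<lambda>t. y t / b)"
      using xm ym c by (intro modular_convex[OF p]) auto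
    also have "\<dots> \<le> ennreal c * 1 + ennreal (1 - c) * 1"
      using a' b' by (intro add_mono mult_left_mono) auto
    also have "\<dots> = 1"
      using c by (simp flip: ennreal_plus)
    finally show ?thesis using a' b' by simp
  qed
  show "(\<lambda>t. x t + y t) \<in> var_Lp p"
    using *[OF less_add_one less_add_one] xm ym
    by (intro var_LpI[where l = "luxemburg_norm p x + 1 + (luxemburg_norm p y + 1)"]) auto
  show "luxemburg_norm p (\<lambda>t. x t + y t) \<le> luxemburg_norm p x + luxemburg_norm p y"
  proof (rule field_le_epsilon)
    fix e :: real assume "0 < e"
    then have "luxemburg_norm p (\<lambda>t. x t + y t)
      \<le> (luxemburg_norm p x + e / 2) + (luxemburg_norm p y + e / 2)"
      using *[of "luxemburg_norm p x + e / 2" "luxemburg_norm p y + e / 2"]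
      by (intro luxemburg_norm_le) auto
    then show "luxemburg_norm p (\<lambda>t. x t + y t) \<le> luxemburg_norm p x + luxemburg_norm p y + e"
      by simp
  qed
qed

lemma luxemburg_scale:
  assumes p: "variable_exponent p" and x: "x \<in> var_Lp p"
  shows "(\<lambda>t. c * x t) \<in> var_Lp p"
    and "luxemburg_norm p (\<lambda>t. c * x t) \<le> \<bar>c\<bar> * luxemburg_norm p x"
proof -
  have xm: "x \<in> borel_measurable leb01"
    using x by (auto simp: var_Lp_def)
  have *: "modular p (\<lambda>t. c * x t / l) \<le> 1 \<and> 0 < l" if l: "\<bar>c\<bar> * luxemburg_norm p x < l" for l
  proof (cases "c = 0")
    case True
    then show ?thesis using l by (simp add: modular_def)
  next
    case False
    have "luxemburg_norm p x < l / \<bar>c\<bar>"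
      using l False by (simp add: field_simps)
    then have k: "0 < l / \<bar>c\<bar>" "modular p (\<lambda>t. x t / (l / \<bar>c\<bar>)) \<le> 1"
      using modular_le_1[OF p x] by blast+
    have "modular p (\<lambda>t. c * x t / l) = modular p (\<lambda>t. x t / (l / \<bar>c\<bar>))"
      by (simp add: modular_def abs_mult abs_divide mult.commute)
    then show ?thesis using k False by (simp add: zero_less_divide_iff)
  qed
  show "(\<lambda>t. c * x t) \<in> var_Lp p"
    using *[OF less_add_one] xm
    by (intro var_LpI[where l = "\<bar>c\<bar> * luxemburg_norm p x + 1"]) auto
  show "luxemburg_norm p (\<lambda>t. c * x t) \<le> \<bar>c\<bar> * luxemburg_norm p x"
    by (rule dense_ge) (use * in \<open>auto intro: luxemburg_norm_le\<close>)
qed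

text \<open>The missing inequality comes from \<open>luxemburg_scale\<close> applied to
  \<open>c * x\<close> with the factor \<open>1 / c\<close>.\<close>

lemma luxemburg_norm_scale:
  assumes p: "variable_exponent p" and x: "x \<in> var_Lp p"
  shows "luxemburg_norm p (\<lambda>t. c * x t) = \<bar>c\<bar> * luxemburg_norm p x"
proof (cases "c = 0")
  case True
  then show ?thesis
    using luxemburg_scale[OF p x, of c] luxemburg_norm_nonneg[OF p, of "\<lambda>t. c * x t"] by simp
next
  case False
  have "luxemburg_norm p (\<lambda>t. (1/c) * (c * x t)) \<le> \<bar>1/c\<bar> * luxemburg_norm p (\<lambda>t. c * x t)"
    by (intro luxemburg_scale(2)[OF p] luxemburg_scale(1)[OF p x])
  then have "\<bar>c\<bar> * luxemburg_norm p x \<le> luxemburg_norm p (\<lambda>t. c * x t)"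
    using False by (simp add: field_simps)
  then show ?thesis
    using luxemburg_scale(2)[OF p x, of c] by simp
qed

section \<open>The subspace of order continuous elements\<close>

lemma var_Ep_subset: "var_Ep p \<subseteq> var_Lp p"
proof
  fix x assume x: "x \<in> var_Ep p"
  then have "modular p (\<lambda>t. 1 * x t) < \<infinity>"
    unfolding var_Ep_def using zero_less_one by blast
  with x show "x \<in> var_Lp p"
    unfolding var_Lp_def var_Ep_def by (auto intro!: exI[of _ "1::real"])
qed

text \<open>The factor 2 in \<open>modular_le_add\<close> does no harm, because all multiples of
  \<open>x\<close> and of \<open>y\<close> have finite modular.\<close>

lemma var_Ep_add:
  assumes p: "variable_exponent p" and x: "x \<in> var_Ep p" and y: "y \<in> var_Ep p"
  shows "(\<lambda>t. x t + y t) \<in> var_Ep p"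
proof -
  have xm: "x \<in> borel_measurable leb01" and ym: "y \<in> borel_measurable leb01"
    using x y by (auto simp: var_Ep_def)
  have "modular p (\<lambda>t. l * (x t + y t)) < \<infinity>" if l: "0 < l" for l
  proof -
    have "modular p (\<lambda>t. l * (x t + y t))
        \<le> modular p (\<lambda>t. 2 * (l * x t)) + modular p (\<lambda>t. 2 * (l * y t))"
    proof (rule modular_le_add[OF p])
      show "\<bar>l * (x t + y t)\<bar> \<le> \<bar>l * x t\<bar> + \<bar>l * y t\<bar>" for t
        using abs_triangle_ineq[of "l * x t" "l * y t"] by (simp add: distrib_left)
    qed (use xm ym in auto)
    also have "\<dots> < \<infinity>"
    proof -
      have "modular p (\<lambda>t. (2 * l) * x t) < \<infinity>" "modular p (\<lambda>t. (2 * l) * y t) < \<infinity>"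
        using x y l unfolding var_Ep_def by (auto simp del: infinity_ennreal_def)
      then show ?thesis by (simp add: mult.assoc)
    qed
    finally show ?thesis .
  qed
  then show ?thesis using xm ym unfolding var_Ep_def by auto
qed

lemma var_Ep_scale:
  assumes x: "x \<in> var_Ep p"
  shows "(\<lambda>t. c * x t) \<in> var_Ep p"
proof -
  have "modular p (\<lambda>t. l * (c * x t)) < \<infinity>" if l: "0 < l" for l
  proof (cases "c = 0")
    case True
    then show ?thesis by (simp add: modular_def)
  next
    case False
    then have "0 < l * \<bar>c\<bar>" using l by simp
    then have "modular p (\<lambda>t. (l * \<bar>c\<bar>) * x t) < \<infinity>"
      using x unfolding var_Ep_def by blast
    then show ?thesis by (simp add: modular_def abs_mult mult.assoc)
  qed
  then show ?thesis using x unfolding var_Ep_def by auto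
qed

section \<open>Intervals of small modular\<close>

lemma emeasure_leb01_interval:
  assumes "0 \<le> a" "a \<le> b" "b \<le> 1"
  shows "{a<..<b} \<in> sets leb01" "emeasure leb01 {a<..<b} = ennreal (b - a)"
proof -
  have sub: "{a<..<b} \<subseteq> {0..1}" using assms by auto
  then show "{a<..<b} \<in> sets leb01"
    by (simp add: sets_restrict_space_iff)
  show "emeasure leb01 {a<..<b} = ennreal (b - a)"
    using sub assms by (simp add: emeasure_restrict_space)
qed

text \<open>A nondegenerate interval has positive measure, so it cannot lie in the exceptional null
  set. This allows evaluation at a point after an almost-everywhere identification.\<close>

lemma AE_leb01_interval_witness:
  assumes P: "AE t in leb01. P t" and ab: "0 \<le> a" "a < b" "b \<le> 1"
  obtains t where "t \<in> {a<..<b}" "P t"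
proof -
  have "\<exists>t\<in>{a<..<b}. P t"
  proof (rule ccontr)
    assume "\<not> ?thesis"
    then have "AE t in leb01. t \<notin> {a<..<b}"
      using P by (auto elim: eventually_mono)
    then have "emeasure leb01 {a<..<b} = 0"
      using ab emeasure_leb01_interval(1)[of a b]
      by (subst (asm) AE_iff_measurable[where N = "{a<..<b}"]) auto
    then show False
      using ab emeasure_leb01_interval(2)[of a b] by simp
  qed
  then show thesis using that by blast
qed

lemma modular_add_disjoint:
  assumes p: "variable_exponent p"
    and x: "x \<in> borel_measurable leb01" and y: "y \<in> borel_measurable leb01"
    and disj: "\<And>t. x t = 0 \<or> y t = 0"
  shows "modular p (\<lambda>t. x t + y t) = modular p x + modular p y"
proof -
  have "ennreal (\<bar>x t + y t\<bar> powr p t) = ennreal (\<bar>x t\<bar> powr p t) + ennreal (\<bar>y t\<bar> powr p t)" for t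
    using disj[of t] by auto
  then show ?thesis
    unfolding modular_def
    by (simp add: nn_integral_add modular_measurable[OF p x] modular_measurable[OF p y])
qed

lemma indicator_interval_measurable [measurable]:
  "(indicator {a<..<b} :: real \<Rightarrow> real) \<in> borel_measurable leb01"
  by (intro borel_measurable_indicator' measurable_restrict_space1) auto

lemma modular_interval_infinite:
  assumes p: "variable_exponent p"
    and big: "\<And>a b. 0 \<le> a \<Longrightarrow> a < b \<Longrightarrow> b \<le> 1 \<Longrightarrow> 1 < modular p (\<lambda>t. c * indicator {a<..<b} t)"
    and ab: "0 \<le> a" "a < b" "b \<le> 1"
  shows "modular p (\<lambda>t. c * indicator {a<..<b} t) = \<infinity>"
proof -
  \<comment> \<open>The interval is halved: the left half contributes at least 1 by
    \<open>big\<close>, the right half at least \<open>n\<close> by induction. This works because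
    \<open>c\<close> is the same for all intervals.\<close>
  have "of_nat n \<le> modular p (\<lambda>t. c * indicator {a<..<b} t)" for n
    using ab
  proof (induction n arbitrary: a b)
    case (Suc n)
    define m where "m = (a + b) / 2"
    have m: "a < m" "m < b" using Suc.prems by (auto simp: m_def)
    have "of_nat (Suc n) \<le> modular p (\<lambda>t. c * indicator {a<..<m} t)
        + modular p (\<lambda>t. c * indicator {m<..<b} t)"
      using add_mono[OF less_imp_le[OF big[of a m]] Suc.IH[of m b]] Suc.prems m by simp
    also have "\<dots> = modular p (\<lambda>t. c * indicator {a<..<m} t + c * indicator {m<..<b} t)"
      using m
      by (intro modular_add_disjoint[OF p, symmetric] borel_measurable_times
          borel_measurable_const indicator_interval_measurable) (auto simp: indicator_def)
    also have "\<dots> \<le> modular p (\<lambda>t. c * indicator {a<..<b} t)"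
      using m by (intro modular_mono[OF p]) (auto simp: indicator_def)
    finally show ?case .
  qed simp
  then show ?thesis
    by (metis ennreal_Ex_less_of_nat infinity_ennreal_def not_less top.not_eq_extremum)
qed

section \<open>Tent functions and the failure of closedness\<close>

lemma sum_power2_le: "(\<Sum>n<k. 2 ^ n) \<le> (2 :: real) ^ k"
  by (induction k) auto

text \<open>For \<open>a < b\<close> this is the tent of height 1 over the interval from
  \<open>a\<close> to \<open>b\<close>, with its peak at the midpoint.\<close>

definition bump :: "real \<Rightarrow> real \<Rightarrow> real \<Rightarrow> real" where
  "bump a b t = max 0 (1 - \<bar>2 * t - (a + b)\<bar> / (b - a))"

lemma bump_nonneg: "0 \<le> bump a b t"
  by (simp add: bump_def)

lemma bump_le_indicator:
  assumes "a < b"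
  shows "bump a b t \<le> indicator {a<..<b} t"
  using assms by (auto simp: bump_def indicator_def field_simps abs_if)

text \<open>The bounds cut out the middle half, where the distance to the midpoint is at most a
  quarter of the length. Being an open interval, it has positive measure.\<close>

lemma bump_ge_half:
  assumes "t \<in> {(3 * a + b) / 4<..<(a + 3 * b) / 4}"
  shows "1 / 2 \<le> bump a b t"
proof -
  have "\<bar>2 * t - (a + b)\<bar> \<le> (b - a) / 2"
    using assms by (auto simp: abs_if field_simps)
  moreover have "a < b" using assms by auto
  ultimately have "\<bar>2 * t - (a + b)\<bar> / (b - a) \<le> 1 / 2"
    by (simp add: field_simps)
  then show ?thesis unfolding bump_def by linarith
qed

lemma continuous_on_bump: "continuous_on S (bump a b)"
  \<comment> \<open>For \<open>a = b\<close> division by zero makes the function constantly 1, so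
    continuity holds there too.\<close>
  unfolding bump_def[abs_def] by (cases "a = b") (auto intro!: continuous_intros)

text \<open>A height of at least 1 stays at least 1 under any nonnegative power. Small modulars thus
  give the small measures needed for Borel-Cantelli.\<close>

lemma emeasure_interval_le_modular:
  assumes p: "variable_exponent p" and ab: "0 \<le> a" "a \<le> b" "b \<le> 1" and c: "1 \<le> c"
  shows "emeasure leb01 {a<..<b} \<le> modular p (\<lambda>t. c * indicator {a<..<b} t)"
proof -
  have "emeasure leb01 {a<..<b} = (\<integral>\<^sup>+ t. indicator {a<..<b} t \<partial>leb01)"
    using emeasure_leb01_interval(1)[OF ab] by simp
  also have "\<dots> \<le> modular p (\<lambda>t. c * indicator {a<..<b} t)"
    unfolding modular_def
  proof (rule nn_integral_mono)
    fix t assume "t \<in> space leb01"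
    then have "0 \<le> p t" using p by (auto simp: variable_exponent_def intro: order_trans[OF zero_le_one])
    then show "indicator {a<..<b} t \<le> ennreal (\<bar>c * indicator {a<..<b} t\<bar> powr p t)"
      using c by (auto simp: indicator_def ge_one_powr_ge_zero simp flip: ennreal_1 intro!: ennreal_leI)
  qed
  finally show ?thesis .
qed

text \<open>
  Otherwise there are bumps of height \<open>2^n\<close> whose norms are so small that their sum converges
  in \<open>var_Lp p\<close> although it is essentially unbounded. At a point lying in
  only finitely many of the supporting intervals, the largest such index \<open>n\<close> bounds the whole
  tail by \<open>2^(n+1)\<close>.
\<close>

lemma closed_C01_imp_modular_interval_gt_1:
  assumes p: "variable_exponent p" and closed: "closed_in_var_Lp p C01"
  shows "\<exists>c>0. \<forall>a b. 0 \<le> a \<longrightarrow> a < b \<longrightarrow> b \<le> 1 \<longrightarrow>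
    1 < modular p (\<lambda>t. c * indicator {a<..<b} t)"
proof (rule ccontr)
  assume "\<not> ?thesis"
  then have "\<exists>a b. 0 \<le> a \<and> a < b \<and> b \<le> 1 \<and> modular p (\<lambda>t. c * indicator {a<..<b} t) \<le> 1"
    if "0 < c" for c :: real
    using that by (meson not_less)
  \<comment> \<open>The exponent splits as \<open>(n + 1) + (2 * n + 1)\<close>. The factor
    \<open>2 ^ (n + 1)\<close> is given up to make the modular at most \<open>2 ^ -(n + 1)\<close>;
    what remains is \<open>h n = 2 ^ n * 2 ^ (n + 1)\<close>, a weight times a tail bound.\<close>
  then have "\<forall>n. \<exists>a b. 0 \<le> a \<and> a < b \<and> b \<le> 1 \<and>
      modular p (\<lambda>t. 2 ^ (3 * n + 2) * indicator {a<..<b} t) \<le> 1"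
    by simp
  then obtain a b where ab: "\<And>n::nat. 0 \<le> a n" "\<And>n. a n < b n" "\<And>n. b n \<le> 1"
    and mod1: "\<And>n. modular p (\<lambda>t. 2 ^ (3 * n + 2) * indicator {a n<..<b n} t) \<le> 1"
    by metis
  define I where "I n = {a n<..<b n}" for n
  define h where "h n = (2::real) ^ (2 * n + 1)" for n :: nat
  have mod_h: "modular p (\<lambda>t. h n * indicator (I n) t) \<le> ennreal ((1/2) ^ Suc n)" for n
  proof -
    have eq: "h n = (1/2) ^ Suc n * 2 ^ (3 * n + 2)"
    proof -
      have "(2::real) ^ (3 * n + 2) = 2 ^ Suc n * h n"
        unfolding h_def power_add[symmetric] by (simp add: algebra_simps)
      then show ?thesis by (simp add: power_one_over)
    qed
    have "modular p (\<lambda>t. h n * indicator (I n) t)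
        = modular p (\<lambda>t. (1/2) ^ Suc n * (2 ^ (3 * n + 2) * indicator (I n) t))"
      unfolding eq by (simp only: mult.assoc)
    also have "\<dots> \<le> ennreal ((1/2) ^ Suc n) * modular p (\<lambda>t. 2 ^ (3 * n + 2) * indicator (I n) t)"
      by (rule modular_scale_le[OF p]) (auto simp: I_def power_le_one simp del: power_Suc)
    also have "\<dots> \<le> ennreal ((1/2) ^ Suc n) * 1"
      unfolding I_def by (intro mult_left_mono mod1) simp
    finally show ?thesis by simp
  qed
  have I_sets [measurable]: "I n \<in> sets leb01" for n
    unfolding I_def using ab[of n] by (intro emeasure_leb01_interval) auto
  have emI: "emeasure leb01 (I n) \<le> ennreal ((1/2) ^ Suc n)" for n
  proof -
    have "1 \<le> h n" unfolding h_def by (rule one_le_power) simp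
    then have "emeasure leb01 (I n) \<le> modular p (\<lambda>t. h n * indicator (I n) t)"
      unfolding I_def using ab[of n] by (intro emeasure_interval_le_modular[OF p]) auto
    then show ?thesis using mod_h order_trans by blast
  qed
  \<comment> \<open>Borel-Cantelli: the measures of the \<open>I n\<close> are dominated by a
    geometric series.\<close>
  have fin: "AE t in leb01. finite {n. t \<in> I n}"
  proof -
    have "AE t in leb01. eventually (\<lambda>n. t \<in> space leb01 - I n) sequentially"
    proof (rule borel_cantelli_AE1)
      show "emeasure leb01 (I n) < \<infinity>" for n
        by (rule le_less_trans[OF emI]) simp
      have "measure leb01 (I n) \<le> (1/2) ^ Suc n" for n
        unfolding measure_def using emI[of n] by (intro enn2real_leI) auto
      then show "summable (\<lambda>n. measure leb01 (I n))"
        by (intro summable_comparison_test'[OF sums_summable[OF power_half_series], of 0])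
          (simp del: power_Suc)
    qed simp
    then show ?thesis
    proof eventually_elim
      case (elim t)
      then obtain N where "\<forall>n\<ge>N. t \<notin> I n"
        by (auto simp: eventually_sequentially)
      then have "{n. t \<in> I n} \<subseteq> {..<N}"
        by (auto simp: not_le[symmetric])
      then show ?case by (rule finite_subset) simp
    qed
  qed
  define v where "v n t = 2 ^ n * bump (a n) (b n) t" for n t
  have v0: "0 \<le> v n t" for n t
    by (simp add: v_def bump_nonneg)
  have v_le: "v n t \<le> 2 ^ n" and v_out: "t \<notin> I n \<Longrightarrow> v n t = 0" for n t
    using bump_le_indicator[OF ab(2), of n t] bump_nonneg[of "a n" "b n" t]
    by (auto simp: v_def I_def split: split_indicator_asm)
  have v_meas [measurable]: "v n \<in> borel_measurable leb01" for n
    unfolding v_def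
    by (intro borel_measurable_times borel_measurable_const continuous_imp_measurable_on_sets_lebesgue
        continuous_on_bump) simp
  \<comment> \<open>Where \<open>t\<close> lies in only finitely many \<open>I n\<close>, hence
    almost everywhere, this is a finite sum. On the remaining null set the series may diverge and
    the value of \<open>suminf\<close> is irrelevant.\<close>
  define g where "g t = (\<Sum>n. v n t)" for t
  define S where "S N t = (\<Sum>n<N. v n t)" for N t
  have g_meas [measurable]: "g \<in> borel_measurable leb01"
    unfolding g_def by measurable
  have S_meas [measurable]: "S N \<in> borel_measurable leb01" for N
    unfolding S_def by measurable
  have S_C: "S N \<in> C01" for N
    unfolding C01_def S_def v_def
    by (auto intro!: continuous_intros continuous_on_bump)
  \<comment> \<open>The factor \<open>2 ^ N\<close> turns a modular bound of 1 into a norm bound of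
    \<open>2 ^ -N\<close>. On the right, the single term with the largest index \<open>m\<close>
    already suffices.\<close>
  have tail: "AE t in leb01. ennreal (\<bar>2 ^ N * (g t - S N t)\<bar> powr p t)
      \<le> (\<Sum>n. ennreal (\<bar>h n * indicator (I n) t\<bar> powr p t))" for N
    using fin AE_space
  proof eventually_elim
    case (elim t)
    define F where "F = {n. t \<in> I n}"
    have F: "finite F" using elim by (simp add: F_def)
    have pt: "0 \<le> p t"
      using elim p by (auto simp: variable_exponent_def intro: order_trans[OF zero_le_one])
    have "g t = (\<Sum>n\<in>F \<union> {..<N}. v n t)"
      unfolding g_def using F by (intro suminf_finite) (auto simp: F_def v_out)
    also have "\<dots> = (\<Sum>n\<in>F - {..<N}. v n t) + S N t"
      unfolding S_def using F
      by (subst sum.union_disjoint[symmetric]) (auto intro: arg_cong[where f = "sum _"])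
    finally have diff: "g t - S N t = (\<Sum>n\<in>F - {..<N}. v n t)" by simp
    show ?case
    proof (cases "F - {..<N} = {}")
      case True
      have "g t - S N t = 0"
        unfolding diff True by (rule sum.empty)
      then have "ennreal (\<bar>2 ^ N * (g t - S N t)\<bar> powr p t) = 0" by simp
      then show ?thesis by (simp only: zero_le)
    next
      case False
      define m where "m = Max (F - {..<N})"
      have "m \<in> F - {..<N}"
        unfolding m_def using F False by (intro Max_in) auto
      then have m: "t \<in> I m" "N \<le> m" by (auto simp: F_def)
      have "g t - S N t \<le> (\<Sum>n\<in>F - {..<N}. 2 ^ n)"
        unfolding diff by (intro sum_mono v_le)
      also have "\<dots> \<le> (\<Sum>n<Suc m. 2 ^ n)"
      proof (rule sum_mono2)
        show "F - {..<N} \<subseteq> {..<Suc m}"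
          unfolding m_def using Max_ge[of "F - {..<N}"] F
          by (meson finite_Diff le_imp_less_Suc lessThan_iff subsetI)
      qed simp_all
      also have "\<dots> \<le> 2 ^ Suc m"
        by (rule sum_power2_le)
      finally have le: "g t - S N t \<le> 2 ^ Suc m" .
      have ge: "0 \<le> g t - S N t"
        unfolding diff by (intro sum_nonneg v0)
      \<comment> \<open>Only indices at least \<open>N\<close> occur in the tail, so the weight
        satisfies \<open>2 ^ N \<le> 2 ^ m\<close>.\<close>
      have "2 ^ N * (g t - S N t) \<le> 2 ^ m * 2 ^ Suc m"
        by (rule mult_mono[OF power_increasing[OF m(2)] le _ ge]) simp_all
      also have "\<dots> = h m"
      proof -
        have "2 * m + 1 = m + Suc m" by simp
        then show ?thesis by (simp only: h_def power_add)
      qed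
      finally have "\<bar>2 ^ N * (g t - S N t)\<bar> powr p t \<le> \<bar>h m * indicator (I m) t\<bar> powr p t"
        using ge m(1) pt by (intro powr_mono2) (simp_all add: h_def abs_mult)
      then have "ennreal (\<bar>2 ^ N * (g t - S N t)\<bar> powr p t)
          \<le> ennreal (\<bar>h m * indicator (I m) t\<bar> powr p t)"
        by (rule ennreal_leI)
      also have "\<dots> = (\<Sum>n\<in>{m}. ennreal (\<bar>h n * indicator (I n) t\<bar> powr p t))"
        by simp
      also have "\<dots> \<le> (\<Sum>n. ennreal (\<bar>h n * indicator (I n) t\<bar> powr p t))"
        by (intro sum_le_suminf) auto
      finally show ?thesis .
    qed
  qed
  have mod_tail: "modular p (\<lambda>t. 2 ^ N * (g t - S N t)) \<le> 1" for N
  proof -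
    have "modular p (\<lambda>t. 2 ^ N * (g t - S N t))
        \<le> (\<integral>\<^sup>+ t. (\<Sum>n. ennreal (\<bar>h n * indicator (I n) t\<bar> powr p t)) \<partial>leb01)"
      unfolding modular_def by (rule nn_integral_mono_AE[OF tail])
    also have "\<dots> = (\<Sum>n. modular p (\<lambda>t. h n * indicator (I n) t))"
      unfolding modular_def by (intro nn_integral_suminf modular_measurable[OF p]) measurable
    also have "\<dots> \<le> (\<Sum>n. ennreal ((1/2) ^ Suc n))"
      by (intro suminf_le mod_h) auto
    also have "\<dots> = ennreal 1"
      by (rule suminf_ennreal_eq[OF _ power_half_series]) simp
    finally show ?thesis by simp
  qed
  have mod_tail': "modular p (\<lambda>t. (g t - S N t) / (1 / 2 ^ N)) \<le> 1" for N
    using mod_tail[of N] by (simp add: mult.commute)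
  \<comment> \<open>The case \<open>N = 0\<close>, where the partial sum is empty, bounds the
    modular of \<open>g\<close> itself.\<close>
  have "g \<in> var_Lp p"
    by (rule var_LpI[where l = 1]) (use mod_tail[of 0] in \<open>auto simp: S_def\<close>)
  moreover have "\<exists>y\<in>C01. luxemburg_norm p (\<lambda>t. g t - y t) < e" if e: "0 < e" for e
  proof -
    obtain N where N: "(1/2::real) ^ N < e"
      using real_arch_pow_inv[OF e, of "1/2"] by auto
    have "luxemburg_norm p (\<lambda>t. g t - S N t) \<le> 1 / 2 ^ N"
      by (intro luxemburg_norm_le mod_tail') simp
    then show ?thesis
      using S_C[of N] N by (intro bexI[of _ "S N"]) (auto simp: power_one_over)
  qed
  ultimately obtain y where y: "y \<in> C01" and gy: "AE t in leb01. g t = y t"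
    using closed unfolding closed_in_var_Lp_def by blast
  have "bounded (y ` {0..1})"
    using y by (intro compact_imp_bounded compact_continuous_image) (auto simp: C01_def)
  then obtain B where B: "\<And>t. t \<in> {0..1} \<Longrightarrow> \<bar>y t\<bar> \<le> B"
    unfolding bounded_iff real_norm_def by blast
  \<comment> \<open>On the middle half of \<open>I n\<close> the bump has at least half its height,
    \<open>2 ^ n / 2\<close>, which exceeds the bound \<open>B\<close> of \<open>y\<close>.\<close>
  obtain n where n: "2 * B < 2 ^ n"
    using real_arch_pow[of 2 "2 * B"] by auto
  have "AE t in leb01. g t = y t \<and> finite {n. t \<in> I n}"
    using gy fin by eventually_elim simp
  then obtain t where t: "t \<in> {(3 * a n + b n) / 4<..<(a n + 3 * b n) / 4}"
    and gt: "g t = y t" "finite {n. t \<in> I n}"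
    by (rule AE_leb01_interval_witness[of _ "(3 * a n + b n) / 4" "(a n + 3 * b n) / 4"])
      (use ab[of n] in auto)
  have "2 ^ n * (1 / 2) \<le> v n t"
    unfolding v_def by (intro mult_left_mono bump_ge_half t) simp
  also have "v n t = (\<Sum>k\<in>{n}. v k t)" by simp
  also have "\<dots> \<le> (\<Sum>k\<in>insert n {k. t \<in> I k}. v k t)"
    using gt v0 by (intro sum_mono2) auto
  also have "\<dots> = g t"
    unfolding g_def using gt v_out by (intro suminf_finite[symmetric]) auto
  also have "\<dots> \<le> B"
    using B[of t] t ab[of n] gt by auto
  finally show False using n by simp
qed

section \<open>Singular extension\<close>

text \<open>The constant does not depend on \<open>y\<close>, so this bounds from below the distance
  of \<open>x\<close> to \<open>var_Ep p\<close>. In \<open>4 * c\<close>, one factor 2 pays for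
  \<open>\<bar>x t\<bar>\<close> being only half the value at \<open>t0\<close>, the other for
  \<open>modular_le_add\<close>.\<close>

lemma sup_norm01_le_luxemburg_norm:
  assumes p: "variable_exponent p" and c: "0 < c"
    and inf: "\<And>a b. 0 \<le> a \<Longrightarrow> a < b \<Longrightarrow> b \<le> 1 \<Longrightarrow> modular p (\<lambda>t. c * indicator {a<..<b} t) = \<infinity>"
    and x: "x \<in> C01" "x \<in> var_Lp p" and y: "y \<in> var_Ep p"
  shows "sup_norm01 x \<le> 4 * c * luxemburg_norm p (\<lambda>t. x t + y t)"
  unfolding sup_norm01_def
proof (rule cSUP_least)
  define N where "N = luxemburg_norm p (\<lambda>t. x t + y t)"
  have xy: "(\<lambda>t. x t + y t) \<in> var_Lp p"
    using y var_Ep_subset by (intro luxemburg_add(1)[OF p x(2)]) auto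
  have xym: "(\<lambda>t. x t + y t) \<in> borel_measurable leb01" and ym: "y \<in> borel_measurable leb01"
    using xy y by (auto simp: var_Lp_def var_Ep_def)
  fix t0 :: real assume t0: "t0 \<in> {0..1}"
  define M where "M = \<bar>x t0\<bar>"
  have "M \<le> 4 * c * N"
  proof (rule ccontr)
    assume "\<not> ?thesis"
    then have N: "N < M / (4 * c)"
      using c by (simp add: field_simps)
    then have le1: "0 < M / (4 * c)" "modular p (\<lambda>t. (x t + y t) / (M / (4 * c))) \<le> 1"
      using modular_le_1[OF p xy, of "M / (4 * c)"] by (auto simp only: N_def)
    then have M: "0 < M" using c by (simp add: zero_less_divide_iff)
    have "\<exists>d>0. \<forall>t\<in>{0..1}. dist t t0 < d \<longrightarrow> dist (x t) (x t0) < M / 2"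
      using x(1)[unfolded C01_def mem_Collect_eq continuous_on_iff, rule_format, OF t0 half_gt_zero[OF M]]
      by simp
    then obtain d where d: "0 < d" "\<And>t. t \<in> {0..1} \<Longrightarrow> \<bar>t - t0\<bar> < d \<Longrightarrow> \<bar>x t - x t0\<bar> < M / 2"
      unfolding dist_real_def by blast
    \<comment> \<open>Clipping to the unit interval keeps \<open>a < b\<close> even when
      \<open>t0\<close> is an endpoint.\<close>
    define a b where "a = max 0 (t0 - d)" and "b = min 1 (t0 + d)"
    have ab: "0 \<le> a" "a < b" "b \<le> 1"
      using d t0 by (auto simp: a_def b_def)
    have big: "M / 2 \<le> \<bar>x t\<bar>" if "t \<in> {a<..<b}" for t
    proof -
      have "\<bar>x t - x t0\<bar> < M / 2"
        using that by (intro d) (auto simp: a_def b_def)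
      then show ?thesis unfolding M_def by linarith
    qed
    \<comment> \<open>Scaled so that \<open>r * (M / 2) = c\<close>; doubling it gives exactly the
      divisor \<open>M / (4 * c)\<close> from \<open>le1\<close>.\<close>
    define r where "r = 2 * c / M"
    have r: "0 < r" using c M by (simp add: r_def)
    have "\<infinity> = modular p (\<lambda>t. c * indicator {a<..<b} t)"
      using inf[OF ab] by simp
    also have "\<dots> \<le> modular p (\<lambda>t. 2 * (r * (x t + y t))) + modular p (\<lambda>t. 2 * (r * y t))"
    proof (rule modular_le_add[OF p])
      fix t
      have "\<bar>c * indicator {a<..<b} t\<bar> \<le> r * \<bar>x t\<bar>"
      proof (cases "t \<in> {a<..<b}")
        case True
        have "c = r * (M / 2)" using M by (simp add: r_def)
        also have "\<dots> \<le> r * \<bar>x t\<bar>"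
          using big[OF True] r by (intro mult_left_mono) auto
        finally show ?thesis using True c by simp
      qed (use r in simp)
      also have "\<dots> \<le> r * (\<bar>x t + y t\<bar> + \<bar>y t\<bar>)"
        using r by (intro mult_left_mono) auto
      finally show "\<bar>c * indicator {a<..<b} t\<bar> \<le> \<bar>r * (x t + y t)\<bar> + \<bar>r * y t\<bar>"
        using r by (simp add: abs_mult flip: distrib_left)
    qed (use xym ym in auto)
    also have "\<dots> < \<infinity>"
    proof -
      have "(\<lambda>t. 2 * (r * (x t + y t))) = (\<lambda>t. (x t + y t) / (M / (4 * c)))"
        using M c by (auto simp: r_def field_simps)
      then have "modular p (\<lambda>t. 2 * (r * (x t + y t))) < \<infinity>"
        using le1(2) by (simp add: le_less_trans[OF _ ennreal_one_less_top])
      moreover have "modular p (\<lambda>t. (2 * r) * y t) < \<infinity>"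
        using y r unfolding var_Ep_def by (auto simp del: infinity_ennreal_def)
      ultimately show ?thesis by (simp add: mult.assoc)
    qed
    finally show False by simp
  qed
  then show "\<bar>x t0\<bar> \<le> 4 * c * luxemburg_norm p (\<lambda>t. x t + y t)"
    by (simp add: M_def N_def)
qed auto

section \<open>Extension of functionals to the whole space\<close>

lemma vector_space_fun: "vector_space (\<lambda>c (x :: 'a \<Rightarrow> real) t. c * x t)"
  by unfold_locales (auto simp: plus_fun_def algebra_simps)

text \<open>Hahn-Banach with \<open>K * luxemburg_norm p\<close> as the sublinear bound;
  \<open>K\<close> must be nonnegative for subadditivity to survive the multiplication.\<close>

lemma var_Lp_extension:
  assumes p: "variable_exponent p" and K: "0 \<le> K"
    and sub: "G \<subseteq> var_Lp p \<times> UNIV" and zero: "((\<lambda>t. 0), 0) \<in> G"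
    and add: "\<And>x y a b. (x, a) \<in> G \<Longrightarrow> (y, b) \<in> G \<Longrightarrow> ((\<lambda>t. x t + y t), a + b) \<in> G"
    and scale: "\<And>c x a. (x, a) \<in> G \<Longrightarrow> ((\<lambda>t. c * x t), c * a) \<in> G"
    and bound: "\<And>x a. (x, a) \<in> G \<Longrightarrow> a \<le> K * luxemburg_norm p x"
  obtains \<phi> where "\<phi> \<in> var_Lp_dual p" "\<And>x a. (x, a) \<in> G \<Longrightarrow> \<phi> x = a"
proof -
  interpret vector_space "\<lambda>c (x :: real \<Rightarrow> real) t. c * x t"
    by (rule vector_space_fun)
  have zero_mem: "(\<lambda>t. 0) \<in> var_Lp p" using sub zero by auto
  have V: "subspace (var_Lp p)"
    using luxemburg_add(1)[OF p] luxemburg_scale(1)[OF p] zero_mem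
    by (simp add: subspace_def plus_fun_def zero_fun_def)
  have q_add: "K * luxemburg_norm p (x + y) \<le> K * luxemburg_norm p x + K * luxemburg_norm p y"
    if "x \<in> var_Lp p" "y \<in> var_Lp p" for x y
    using mult_left_mono[OF luxemburg_add(2)[OF p that] K]
    by (simp add: plus_fun_def distrib_left)
  have q_scale: "K * luxemburg_norm p (\<lambda>t. c * x t) = c * (K * luxemburg_norm p x)"
    if "0 < c" "x \<in> var_Lp p" for c x
    using luxemburg_norm_scale[OF p that(2), of c] that by simp
  obtain \<phi> :: "(real \<Rightarrow> real) \<Rightarrow> real" where \<phi>:
    "\<And>x y. x \<in> var_Lp p \<Longrightarrow> y \<in> var_Lp p \<Longrightarrow> \<phi> (x + y) = \<phi> x + \<phi> y"
    "\<And>c x. x \<in> var_Lp p \<Longrightarrow> \<phi> (\<lambda>t. c * x t) = c * \<phi> x"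
    "\<And>x. x \<in> var_Lp p \<Longrightarrow> \<phi> x \<le> K * luxemburg_norm p x"
    "\<And>x a. (x, a) \<in> G \<Longrightarrow> \<phi> x = a"
    by (rule hahn_banach[OF vector_space_fun V q_add q_scale sub])
      (use zero add scale bound in \<open>auto simp: plus_fun_def zero_fun_def\<close>)
  \<comment> \<open>The one-sided bound is applied to \<open>x\<close> and to \<open>- x\<close>,
    which have the same norm.\<close>
  have "\<bar>\<phi> x\<bar> \<le> K * luxemburg_norm p x" if x: "x \<in> var_Lp p" for x
    using \<phi>(3)[OF x] \<phi>(3)[OF luxemburg_scale(1)[OF p x, of "- 1"]] \<phi>(2)[OF x, of "- 1"]
      luxemburg_norm_scale[OF p x, of "- 1"]
    by simp
  then have "\<phi> \<in> var_Lp_dual p"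
    using \<phi>(1,2) unfolding bounded_functionals_def linear_functional_on_def plus_fun_def by blast
  then show thesis using \<phi>(4) that by blast
qed

theorem theorem1p1:
  fixes p :: "real \<Rightarrow> real" and f :: "(real \<Rightarrow> real) \<Rightarrow> real"
  assumes "variable_exponent p"
    and "closed_in_var_Lp p C01"
    and "f \<in> bounded_functionals C01 sup_norm01"
  shows "\<exists>\<phi>. singular_functional p \<phi> \<and> (\<forall>x\<in>C01. \<phi> x = f x)"
proof -
  note p = assms(1)
  have C_Lp: "C01 \<subseteq> var_Lp p"
    using assms(2) by (simp add: closed_in_var_Lp_def)
  obtain c where c: "0 < c" and inf: "\<And>a b. 0 \<le> a \<Longrightarrow> a < b \<Longrightarrow> b \<le> 1 \<Longrightarrow>
      modular p (\<lambda>t. c * indicator {a<..<b} t) = \<infinity>"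
    using closed_C01_imp_modular_interval_gt_1[OF p assms(2)] modular_interval_infinite[OF p]
    by metis
  have f_add: "f (\<lambda>t. x t + y t) = f x + f y" and f_scale: "f (\<lambda>t. k * x t) = k * f x"
    if "x \<in> C01" "y \<in> C01" for x y k
    using assms(3) that by (auto simp: bounded_functionals_def linear_functional_on_def)
  have C0: "(\<lambda>t. 0) \<in> C01" by (simp add: C01_def)
  have f0: "f (\<lambda>t. 0) = 0"
    using f_scale[OF C0 C0, of 0] by simp
  obtain K0 where "\<And>x. x \<in> C01 \<Longrightarrow> \<bar>f x\<bar> \<le> K0 * sup_norm01 x"
    using assms(3) by (auto simp: bounded_functionals_def)
  moreover have "0 \<le> sup_norm01 x" if "x \<in> C01" for x
  proof -
    have "compact ((\<lambda>t. \<bar>x t\<bar>) ` {0..1})"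
      using that by (intro compact_continuous_image continuous_intros) (auto simp: C01_def)
    then have "\<bar>x 0\<bar> \<le> sup_norm01 x"
      unfolding sup_norm01_def
      by (intro cSUP_upper bounded_imp_bdd_above compact_imp_bounded) auto
    then show ?thesis by linarith
  qed
  \<comment> \<open>Since the supremum norm is nonnegative, \<open>K0\<close> may be replaced by its
    absolute value.\<close>
  ultimately obtain K where K: "0 \<le> K" "\<And>x. x \<in> C01 \<Longrightarrow> f x \<le> K * sup_norm01 x"
    by (metis abs_ge_self abs_ge_zero mult_right_mono order_trans)
  have E0: "(\<lambda>t. 0) \<in> var_Ep p"
    by (simp add: var_Ep_def modular_def)
  \<comment> \<open>The graph of \<open>x + y \<mapsto> f x\<close>. That the value does not depend
    on the decomposition follows from the norm bound established for \<open>G\<close> below.\<close>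
  define G where "G = {((\<lambda>t. x t + y t), f x) | x y. x \<in> C01 \<and> y \<in> var_Ep p}"
  have GI: "(z, f x) \<in> G" if "x \<in> C01" "y \<in> var_Ep p" "z = (\<lambda>t. x t + y t)" for x y z
    using that unfolding G_def by blast
  have GE: "\<exists>x y. x \<in> C01 \<and> y \<in> var_Ep p \<and> z = (\<lambda>t. x t + y t) \<and> a = f x" if "(z, a) \<in> G" for z a
    using that unfolding G_def by blast
  have "\<exists>\<phi>. \<phi> \<in> var_Lp_dual p \<and> (\<forall>z a. (z, a) \<in> G \<longrightarrow> \<phi> z = a)"
  proof (rule var_Lp_extension[OF p, where G = G and K = "K * (4 * c)"])
    show "0 \<le> K * (4 * c)" using K c by simp
    show "G \<subseteq> var_Lp p \<times> UNIV"
      unfolding G_def using C_Lp var_Ep_subset by (auto intro!: luxemburg_add(1)[OF p])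
    show "((\<lambda>t. 0), 0) \<in> G"
      using GI[OF C0 E0] by (simp add: f0)
    show "((\<lambda>t. z t + w t), a + b) \<in> G" if za: "(z, a) \<in> G" and wb: "(w, b) \<in> G" for z w a b
    proof -
      obtain x y x' y' where *: "x \<in> C01" "y \<in> var_Ep p" "z = (\<lambda>t. x t + y t)" "a = f x"
        "x' \<in> C01" "y' \<in> var_Ep p" "w = (\<lambda>t. x' t + y' t)" "b = f x'"
        using GE[OF za] GE[OF wb] by blast
      have "((\<lambda>t. z t + w t), f (\<lambda>t. x t + x' t)) \<in> G"
        using * by (intro GI[where y = "\<lambda>t. y t + y' t"] var_Ep_add[OF p])
          (auto simp: C01_def intro: continuous_on_add)
      then show ?thesis using * by (simp add: f_add)
    qed
    show "((\<lambda>t. k * z t), k * a) \<in> G" if za: "(z, a) \<in> G" for k z a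
    proof -
      obtain x y where *: "x \<in> C01" "y \<in> var_Ep p" "z = (\<lambda>t. x t + y t)" "a = f x"
        using GE[OF za] by blast
      have "((\<lambda>t. k * z t), f (\<lambda>t. k * x t)) \<in> G"
        using * by (intro GI[where y = "\<lambda>t. k * y t"] var_Ep_scale)
          (auto simp: C01_def distrib_left intro!: continuous_intros)
      then show ?thesis using * by (simp add: f_scale[OF *(1) *(1)])
    qed
    show "a \<le> K * (4 * c) * luxemburg_norm p z" if za: "(z, a) \<in> G" for z a
    proof -
      obtain x y where *: "x \<in> C01" "y \<in> var_Ep p" "z = (\<lambda>t. x t + y t)" "a = f x"
        using GE[OF za] by blast
      have "a \<le> K * sup_norm01 x" using K * by simp
      also have "\<dots> \<le> K * (4 * c * luxemburg_norm p z)"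
        unfolding *(3) using * C_Lp K
        by (intro mult_left_mono sup_norm01_le_luxemburg_norm[OF p c inf]) auto
      finally show ?thesis by (simp add: mult.assoc)
    qed
  qed blast
  then obtain \<phi> where \<phi>: "\<phi> \<in> var_Lp_dual p" "\<And>z a. (z, a) \<in> G \<Longrightarrow> \<phi> z = a"
    by blast
  \<comment> \<open>Decomposing as \<open>x + 0\<close> gives the extension property, and
    \<open>0 + y\<close> gives singularity.\<close>
  have "\<phi> x = f x" if "x \<in> C01" for x
    using \<phi>(2)[OF GI[OF that E0]] by simp
  moreover have "\<phi> y = 0" if "y \<in> var_Ep p" for y
    using \<phi>(2)[OF GI[OF C0 that]] by (simp add: f0)
  ultimately show ?thesis
    using \<phi>(1) unfolding singular_functional_def by blast
qed

end
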